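(* Suppose that the basic sequence $Q$ is infinite in limit and fully divergent. Then $N(Q)\setminus DN(Q)\ne\emptyset$.
   Context: A basic sequence is a sequence $Q=(q_n)_{n\ge1}$ of integers $q_n\ge 2$. The $Q$-Cantor series expansion of $x\in\mathbb{R}$ is the unique expansion $x=E_0+\sum_{n\ge1}\frac{E_n}{q_1\cdots q_n}$ with $E_0=\lfloor x\rfloor$, $E_n\in\{0,\ldots,q_n-1\}$ for $n\ge 1$, and $E_n\ne q_n-1$ infinitely often. $Q$ is infinite in limit if $q_n\to\infty$. Put $Q_n^{(k)}=\sum_{j=1}^n\frac1{q_jq_{j+1}\cdots q_{j+k-1}}$; $Q$ is fully divergent if $\lim_nQ_n^{(k)}=\infty$ for all $k\ge1$. A block of length $k$ is an ordered $k$-tuple of non-negative integers, and $N_n^Q(B,x)$ is the number of occurrences of $B$ starting at positions $\le n$ in the digits $E_1,E_2,\ldots$ of $x$. $N(Q)$ is the set of $x\in\mathbb{R}$ with $\lim_nN_n^Q(B,x)/Q_n^{(k)}=1$ for all $k\ge1$ and all blocks $B$ of length $k$. $DN(Q)$ is the set of $x\in\mathbb{R}$ such that $(q_1\cdots q_nx\bmod1)_{n\ge0}$ is uniformly distributed mod $1$. *)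

theory Defs
  imports "HOL-Analysis.Analysis"
begin

text \<open>
  A basic sequence is indexed by \<open>n \<ge> 1\<close>; the value \<open>q 0\<close> is never used.
\<close>

definition basic_sequence :: "(nat \<Rightarrow> nat) \<Rightarrow> bool" where
  "basic_sequence q \<longleftrightarrow> (\<forall>n\<ge>1. q n \<ge> 2)"

definition infinite_in_limit :: "(nat \<Rightarrow> nat) \<Rightarrow> bool" where
  "infinite_in_limit q \<longleftrightarrow> filterlim q at_top sequentially"

text \<open>\<open>block_sum q k n\<close> is $Q_n^{(k)}$.\<close>

definition block_sum :: "(nat \<Rightarrow> nat) \<Rightarrow> nat \<Rightarrow> nat \<Rightarrow> real" where
  "block_sum q k n = (\<Sum>j=1..n. 1 / real (\<Prod>i<k. q (j + i)))"

definition fully_divergent :: "(nat \<Rightarrow> nat) \<Rightarrow> bool" where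
  "fully_divergent q \<longleftrightarrow> (\<forall>k\<ge>1. filterlim (block_sum q k) at_top sequentially)"

text \<open>
  The integer part \<open>E 0\<close> may be negative, so the digit sequence is integer-valued.
  For a basic sequence \<open>q\<close> every real \<open>x\<close> has exactly one such expansion,
  which justifies the definite description in \<open>cantor_digits\<close>.
\<close>

definition is_cantor_expansion :: "(nat \<Rightarrow> nat) \<Rightarrow> real \<Rightarrow> (nat \<Rightarrow> int) \<Rightarrow> bool" where
  "is_cantor_expansion q x E \<longleftrightarrow>
     E 0 = \<lfloor>x\<rfloor> \<and>
     (\<forall>n\<ge>1. E n \<in> {0..int (q n) - 1}) \<and>
     infinite {n. n \<ge> 1 \<and> E n \<noteq> int (q n) - 1} \<and>
     (\<lambda>n. real_of_int (E (Suc n)) / real (\<Prod>j=1..Suc n. q j)) sums (x - real_of_int (E 0))"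

definition cantor_digits :: "(nat \<Rightarrow> nat) \<Rightarrow> real \<Rightarrow> nat \<Rightarrow> int" where
  "cantor_digits q x = (THE E. is_cantor_expansion q x E)"

text \<open>
  Only the starting position of an occurrence is bounded by \<open>n\<close>; the occurrence itself
  may extend beyond position \<open>n\<close>. Position \<open>0\<close> (the integer part) is not counted.
\<close>

definition block_count :: "(nat \<Rightarrow> nat) \<Rightarrow> nat list \<Rightarrow> real \<Rightarrow> nat \<Rightarrow> nat" where
  "block_count q B x n =
     card {i \<in> {1..n}. \<forall>j<length B. cantor_digits q x (i + j) = int (B ! j)}"

text \<open>The set $N(Q)$ of $Q$-normal numbers.\<close>

definition normal_numbers :: "(nat \<Rightarrow> nat) \<Rightarrow> real set" where
  "normal_numbers q =
     {x. \<forall>k\<ge>1. \<forall>B. length B = k \<longrightarrow>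
           (\<lambda>n. real (block_count q B x n) / block_sum q k n) \<longlonglongrightarrow> 1}"

definition uniformly_distributed_mod1 :: "(nat \<Rightarrow> real) \<Rightarrow> bool" where
  "uniformly_distributed_mod1 y \<longleftrightarrow>
     (\<forall>a b. 0 \<le> a \<and> a < b \<and> b \<le> 1 \<longrightarrow>
        (\<lambda>N. real (card {n. n < N \<and> frac (y n) \<in> {a..<b}}) / real N) \<longlonglongrightarrow> b - a)"

text \<open>The set $DN(Q)$ of $Q$-distribution normal numbers.\<close>

definition distribution_normal_numbers :: "(nat \<Rightarrow> nat) \<Rightarrow> real set" where
  "distribution_normal_numbers q =
     {x. uniformly_distributed_mod1 (\<lambda>n. real (\<Prod>j=1..n. q j) * x)}"

end

(*
  Draw the digits independently and uniformly from {0, ..., q_n - 1}. The events "B occurs at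
  position i" are k-dependent, so Chebyshev and Borel-Cantelli along a sparse subsequence show
  that almost every draw w has the block frequencies of a Q-normal number. Now replace
  every digit w_n by min (w_n, q_n div 2 - 1). Since q_n tends to infinity, each fixed block gains
  or loses only finitely many occurrences, so Q-normality survives; but every fractional part of
  q_1 ... q_n x now lies below 1/2, so x is not Q-distribution normal.
*)
theory Submission
  imports Defs "HOL-Probability.Probability" "HOL-Real_Asymp.Real_Asymp"
begin

section \<open>Almost sure growth of counts of weakly dependent events\<close>

text \<open>If \<open>N m \<le> n < N (Suc m)\<close>, monotonicity places
  \<open>S n / \<mu> n\<close> between \<open>S (N m) / \<mu> (N (Suc m))\<close> and
  \<open>S (N (Suc m)) / \<mu> (N m)\<close>. Both bounds tend to 1 because consecutive values of
  \<open>\<mu>\<close> along \<open>N\<close> are asymptotically equal.\<close>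

lemma tendsto_ratio_of_subseq:
  fixes S \<mu> :: "nat \<Rightarrow> real" and N :: "nat \<Rightarrow> nat"
  assumes "mono S" "mono \<mu>" and S0: "\<And>n. S n \<ge> 0" and pos: "\<And>m. \<mu> (N m) > 0"
    and N: "filterlim N at_top sequentially"
    and \<mu>: "(\<lambda>m. \<mu> (N (Suc m)) / \<mu> (N m)) \<longlonglongrightarrow> 1"
    and S: "(\<lambda>m. S (N m) / \<mu> (N m)) \<longlonglongrightarrow> 1"
  shows "(\<lambda>n. S n / \<mu> n) \<longlonglongrightarrow> 1"
proof -
  define r where "r m = (S (N m) / \<mu> (N m)) / (\<mu> (N (Suc m)) / \<mu> (N m))" for m
  define R where "R m = (S (N (Suc m)) / \<mu> (N (Suc m))) * (\<mu> (N (Suc m)) / \<mu> (N m))" for m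
  have r: "r \<longlonglongrightarrow> 1"
    unfolding r_def using tendsto_divide[OF S \<mu>] by simp
  have R: "R \<longlonglongrightarrow> 1"
    unfolding R_def using tendsto_mult[OF LIMSEQ_Suc[OF S] \<mu>] by simp
  have sandwich: "\<exists>m\<ge>M. r m \<le> S n / \<mu> n \<and> S n / \<mu> n \<le> R m" if n: "N M \<le> n" for M n
  proof -
    \<comment> \<open>\<open>N\<close> is not assumed monotone, so \<open>m\<close> is chosen as the
      least index from \<open>M\<close> on with \<open>n < N (Suc m)\<close>; minimality then yields
      \<open>N m \<le> n\<close>.\<close>
    have "\<exists>m. m \<ge> M \<and> n < N (Suc m)"
    proof -
      have "eventually (\<lambda>m. Suc n \<le> N (Suc m) \<and> m \<ge> M) sequentially"
        using N[THEN filterlim_compose[OF _ filterlim_Suc]]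
        by (intro eventually_conj eventually_ge_at_top) (simp add: filterlim_at_top)
      then show ?thesis
        by (auto simp: eventually_sequentially Suc_le_eq)
    qed
    then obtain m where m: "m \<ge> M" "n < N (Suc m)"
      and least: "\<And>l. l < m \<Longrightarrow> \<not> (l \<ge> M \<and> n < N (Suc l))"
      using exists_least_iff[of "\<lambda>m. m \<ge> M \<and> n < N (Suc m)"] by blast
    have "N m \<le> n"
    proof (cases "m = M")
      case False
      then have "m - 1 < m" "m - 1 \<ge> M" "Suc (m - 1) = m" using m by auto
      then show ?thesis using least[of "m - 1"] by auto
    qed (use n in simp)
    then have le: "\<mu> (N m) \<le> \<mu> n" "S (N m) \<le> S n" "\<mu> n \<le> \<mu> (N (Suc m))" "S n \<le> S (N (Suc m))"
      using m \<open>mono S\<close> \<open>mono \<mu>\<close> by (auto simp: mono_def)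
    have "r m = S (N m) / \<mu> (N (Suc m))"
      using pos[of m] by (simp add: r_def)
    also have "\<dots> \<le> S n / \<mu> n"
      using le pos[of m] S0 by (intro frac_le) auto
    finally have "r m \<le> S n / \<mu> n" .
    moreover have "S n / \<mu> n \<le> S (N (Suc m)) / \<mu> (N m)"
      using le pos[of m] S0 by (intro frac_le) auto
    moreover have "R m = S (N (Suc m)) / \<mu> (N m)"
      using pos[of "Suc m"] by (simp add: R_def)
    ultimately show ?thesis using m by auto
  qed
  show ?thesis
  proof (rule order_tendstoI)
    fix a :: real assume "a < 1"
    then obtain M where "\<And>m. m \<ge> M \<Longrightarrow> a < r m"
      using order_tendstoD(1)[OF r] by (auto simp: eventually_sequentially)
    with sandwich[of M] have "\<forall>n\<ge>N M. a < S n / \<mu> n"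
      by (meson less_le_trans)
    then show "eventually (\<lambda>n. a < S n / \<mu> n) sequentially"
      by (auto simp: eventually_sequentially)
  next
    fix a :: real assume "a > 1"
    then obtain M where "\<And>m. m \<ge> M \<Longrightarrow> R m < a"
      using order_tendstoD(2)[OF R] by (auto simp: eventually_sequentially)
    with sandwich[of M] have "\<forall>n\<ge>N M. S n / \<mu> n < a"
      by (meson le_less_trans)
    then show "eventually (\<lambda>n. S n / \<mu> n < a) sequentially"
      by (auto simp: eventually_sequentially)
  qed
qed

context prob_space
begin

lemma integrable_indicator_event [simp]:
  "B \<in> events \<Longrightarrow> integrable M (indicator B :: 'a \<Rightarrow> real)"
  by (simp add: integrable_indicator_iff emeasure_eq_measure)

text \<open>The variance is the sum of all covariances. Those with indices at distance at least
  \<open>k\<close> vanish; for each \<open>i\<close> at most \<open>2 * k\<close> others remain,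
  each bounded by \<open>prob (A i)\<close>.\<close>

lemma variance_count_le:
  fixes A :: "nat \<Rightarrow> 'a set"
  assumes ev [measurable]: "\<And>i. A i \<in> events"
    and indep: "\<And>i j. i + k \<le> j \<Longrightarrow> prob (A i \<inter> A j) = prob (A i) * prob (A j)"
  shows "variance (\<lambda>x. \<Sum>i<n. indicator (A i) x) \<le> 2 * real k * (\<Sum>i<n. prob (A i))"
proof -
  let ?X = "\<lambda>x. \<Sum>i<n. indicator (A i) x :: real"
  have sq: "?X x ^ 2 = (\<Sum>i<n. \<Sum>j<n. indicator (A i \<inter> A j) x)" for x
    by (simp add: power2_eq_square sum_product indicator_inter_arith)
  have EX: "expectation ?X = (\<Sum>i<n. prob (A i))"
    by (subst Bochner_Integration.integral_sum) auto
  have "expectation (\<lambda>x. ?X x ^ 2) = (\<Sum>i<n. expectation (\<lambda>x. \<Sum>j<n. indicator (A i \<inter> A j) x))"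
    unfolding sq
    by (intro Bochner_Integration.integral_sum Bochner_Integration.integrable_sum
        integrable_indicator_event sets.Int ev)
  also have "\<dots> = (\<Sum>i<n. \<Sum>j<n. expectation (indicator (A i \<inter> A j)))"
    by (intro sum.cong refl Bochner_Integration.integral_sum integrable_indicator_event sets.Int ev)
  also have "\<dots> = (\<Sum>i<n. \<Sum>j<n. prob (A i \<inter> A j))"
    by (simp add: Int_absorb2 sets.sets_into_space sets.Int ev)
  finally have EX2: "expectation (\<lambda>x. ?X x ^ 2) = (\<Sum>i<n. \<Sum>j<n. prob (A i \<inter> A j))" .
  have intX: "integrable M ?X"
    by (intro Bochner_Integration.integrable_sum integrable_indicator_event ev)
  have intX2: "integrable M (\<lambda>x. ?X x ^ 2)"
    unfolding sq by (intro Bochner_Integration.integrable_sum integrable_indicator_event sets.Int ev)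
  have "variance ?X = (\<Sum>i<n. \<Sum>j<n. prob (A i \<inter> A j) - prob (A i) * prob (A j))"
    by (simp only: variance_eq[OF intX intX2] EX2)
      (simp add: EX power2_eq_square sum_product sum_subtractf)
  also have "\<dots> \<le> (\<Sum>i<n. 2 * real k * prob (A i))"
  proof (intro sum_mono)
    fix i assume "i \<in> {..<n}"
    have "(\<Sum>j<n. prob (A i \<inter> A j) - prob (A i) * prob (A j))
      \<le> (\<Sum>j<n. if i < j + k \<and> j < i + k then prob (A i) else 0)"
    proof (intro sum_mono)
      fix j
      consider "i + k \<le> j" | "j + k \<le> i" | "i < j + k \<and> j < i + k" by linarith
      then show "prob (A i \<inter> A j) - prob (A i) * prob (A j)
          \<le> (if i < j + k \<and> j < i + k then prob (A i) else 0)"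
      proof cases
        case 3
        have "prob (A i \<inter> A j) \<le> prob (A i)" by (intro finite_measure_mono) auto
        then have "prob (A i \<inter> A j) - prob (A i) * prob (A j) \<le> prob (A i)"
          by (smt (verit) measure_nonneg mult_nonneg_nonneg)
        then show ?thesis using 3 by simp
      qed (use indep[of i j] indep[of j i] in \<open>auto simp: Int_commute mult.commute\<close>)
    qed
    also have "\<dots> = card {j\<in>{..<n}. i < j + k \<and> j < i + k} * prob (A i)"
      by (simp add: sum.If_cases Int_def)
    \<comment> \<open>Truncation of \<open>i + 1 - k\<close> at 0 only shortens the interval, so it
      never has more than \<open>2 * k\<close> elements.\<close>
    also have "card {j\<in>{..<n}. i < j + k \<and> j < i + k} \<le> card {i + 1 - k..<i + k}"
      by (intro card_mono) auto
    then have "card {j\<in>{..<n}. i < j + k \<and> j < i + k} * prob (A i) \<le> 2 * real k * prob (A i)"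
      by (intro mult_right_mono) auto
    finally show "(\<Sum>j<n. prob (A i \<inter> A j) - prob (A i) * prob (A j)) \<le> 2 * real k * prob (A i)" .
  qed
  finally show ?thesis by (simp add: sum_distrib_left)
qed

text \<open>A strong law: since the variance grows at most linearly in the mean, Chebyshev and
  Borel-Cantelli give convergence along a sparse subsequence, and monotonicity of the counts fills
  the gaps.\<close>

lemma AE_count_ratio_tendsto_1:
  fixes A :: "nat \<Rightarrow> 'a set"
  assumes ev [measurable]: "\<And>i. A i \<in> events"
    and indep: "\<And>i j. i + k \<le> j \<Longrightarrow> prob (A i \<inter> A j) = prob (A i) * prob (A j)"
    and div: "filterlim (\<lambda>n. \<Sum>i<n. prob (A i)) at_top sequentially"
  shows "AE x in M. (\<lambda>n. (\<Sum>i<n. indicator (A i) x) / (\<Sum>i<n. prob (A i))) \<longlonglongrightarrow> 1"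
proof -
  define \<mu> where "\<mu> n = (\<Sum>i<n. prob (A i))" for n
  define S where "S n x = (\<Sum>i<n. indicator (A i) x :: real)" for n x
  \<comment> \<open>Fourth powers leave room for deviations of relative size \<open>1 / Suc m\<close>, so that a single
     application of Borel-Cantelli already yields convergence along the subsequence.\<close>
  define a where "a m = real (Suc m) ^ 4" for m
  define N where "N m = (LEAST n. a m \<le> \<mu> n)" for m
  have mono: "mono \<mu>"
    unfolding \<mu>_def by (intro monoI sum_mono2) auto
  have ex: "\<exists>n. a m \<le> \<mu> n" for m
    using div unfolding \<mu>_def filterlim_at_top eventually_sequentially by blast
  have lower: "a m \<le> \<mu> (N m)" for m
    unfolding N_def using ex by (rule LeastI_ex)
  have a1: "a m \<ge> 1" for m
    unfolding a_def by (intro one_le_power) auto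
  then have a0: "a m > 0" for m
    using less_le_trans[OF zero_less_one] by blast
  \<comment> \<open>Each summand is at most 1, so the first passage over \<open>a m\<close>
    overshoots by at most 1.\<close>
  have upper: "\<mu> (N m) \<le> a m + 1" for m
  proof (cases "N m")
    case 0
    then show ?thesis using a1[of m] by (simp add: \<mu>_def)
  next
    case (Suc l)
    then have "\<mu> l < a m" unfolding N_def using not_less_Least[of l "\<lambda>n. a m \<le> \<mu> n"] by simp
    moreover have "\<mu> (Suc l) \<le> \<mu> l + 1" by (simp add: \<mu>_def)
    ultimately show ?thesis using Suc by simp
  qed
  have pos: "\<mu> (N m) > 0" for m
    using lower[of m] a1[of m] by simp
  have N_ge: "N m \<ge> m" for m
  proof -
    have "\<mu> (N m) \<le> real (N m)"
      unfolding \<mu>_def using sum_bounded_above[of "{..<N m}" "\<lambda>i. prob (A i)" 1] by simp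
    moreover have "real (Suc m) \<le> a m"
      unfolding a_def by (rule self_le_power) auto
    ultimately show ?thesis using lower[of m] by simp
  qed
  have N: "filterlim N at_top sequentially"
    by (rule filterlim_at_top_mono[OF filterlim_ident]) (use N_ge in auto)
  \<comment> \<open>The means along \<open>N\<close> stay within 1 of \<open>a m\<close>, and
    polynomial growth of \<open>a\<close> makes consecutive ratios tend to 1; geometric growth would
    not.\<close>
  have \<mu>_ratio: "(\<lambda>m. \<mu> (N (Suc m)) / \<mu> (N m)) \<longlonglongrightarrow> 1"
  proof (rule tendsto_sandwich)
    show "eventually (\<lambda>m. a (Suc m) / (a m + 1) \<le> \<mu> (N (Suc m)) / \<mu> (N m)) sequentially"
      using lower upper pos a0 by (intro always_eventually allI frac_le) (auto intro: less_imp_le)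
    show "eventually (\<lambda>m. \<mu> (N (Suc m)) / \<mu> (N m) \<le> (a (Suc m) + 1) / a m) sequentially"
      using lower upper pos a0 add_nonneg_nonneg[OF less_imp_le[OF a0] zero_le_one]
      by (intro always_eventually allI frac_le) auto
    show "(\<lambda>m. a (Suc m) / (a m + 1)) \<longlonglongrightarrow> 1" "(\<lambda>m. (a (Suc m) + 1) / a m) \<longlonglongrightarrow> 1"
      unfolding a_def by real_asymp+
  qed
  define D where "D m = {x\<in>space M. \<mu> (N m) / real (Suc m) \<le> \<bar>S (N m) x - \<mu> (N m)\<bar>}" for m
  have D [measurable]: "D m \<in> events" for m
    unfolding D_def S_def by measurable
  have ES: "expectation (S n) = \<mu> n" for n
    unfolding S_def \<mu>_def by (subst Bochner_Integration.integral_sum) auto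
  have int: "integrable M (\<lambda>x. S n x ^ 2)" for n
    unfolding S_def by (simp add: power2_eq_square sum_product sets.Int flip: indicator_inter_arith)
  have rv: "random_variable borel (S n)" for n
    unfolding S_def by measurable
  \<comment> \<open>Chebyshev gives \<open>2 * k * (Suc m)^2 / \<mu> (N m)\<close>, and the fourth
    power in \<open>a m\<close> turns this into a summable bound.\<close>
  have D_le: "prob (D m) \<le> 2 * real k * (1 / real (Suc m) ^ 2)" for m
  proof -
    have "prob (D m) \<le> variance (S (N m)) / (\<mu> (N m) / real (Suc m))\<^sup>2"
      using Chebyshev_inequality[OF rv int, of "\<mu> (N m) / real (Suc m)" "N m"] pos[of m]
      by (simp add: D_def ES)
    also have "\<dots> \<le> (2 * real k * \<mu> (N m)) / (\<mu> (N m) / real (Suc m))\<^sup>2"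
      unfolding S_def \<mu>_def by (intro divide_right_mono variance_count_le indep ev) auto
    also have "\<dots> = 2 * real k * (real (Suc m) ^ 2 / \<mu> (N m))"
      using pos[of m] by (simp add: power2_eq_square field_simps)
    also have "\<dots> \<le> 2 * real k * (real (Suc m) ^ 2 / a m)"
      using lower[of m] a1[of m] by (intro mult_left_mono divide_left_mono) (auto intro: mult_pos_pos pos)
    also have "real (Suc m) ^ 2 / a m = 1 / real (Suc m) ^ 2"
      unfolding a_def by (simp add: power2_eq_square power4_eq_xxxx del: of_nat_Suc)
    finally show ?thesis .
  qed
  have "summable (\<lambda>m. prob (D m))"
  proof (rule summable_comparison_test')
    have "summable (\<lambda>m. 1 / real (Suc m) ^ 2)"
      using inverse_power_summable[of 2, where 'a = real]
      by (subst summable_Suc_iff) (simp add: inverse_eq_divide)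
    then show "summable (\<lambda>m. 2 * real k * (1 / real (Suc m) ^ 2))"
      by (rule summable_mult)
    show "norm (prob (D m)) \<le> 2 * real k * (1 / real (Suc m) ^ 2)" if "m \<ge> 0" for m
      using D_le[of m] by simp
  qed
  then have "AE x in M. eventually (\<lambda>m. x \<in> space M - D m) sequentially"
    by (intro borel_cantelli_AE1) (auto simp: emeasure_eq_measure)
  then show ?thesis
  proof eventually_elim
    case (elim x)
    have "(\<lambda>m. S (N m) x / \<mu> (N m) - 1) \<longlonglongrightarrow> 0"
    proof (rule Lim_null_comparison)
      show "eventually (\<lambda>m. norm (S (N m) x / \<mu> (N m) - 1) \<le> 1 / real (Suc m)) sequentially"
        using elim
      proof eventually_elim
        case (elim m)
        then have "\<bar>S (N m) x - \<mu> (N m)\<bar> < \<mu> (N m) / real (Suc m)"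
          by (auto simp: D_def)
        moreover have "S (N m) x / \<mu> (N m) - 1 = (S (N m) x - \<mu> (N m)) / \<mu> (N m)"
          using pos[of m] by (simp add: field_simps)
        ultimately show ?case
          using pos[of m] by (simp add: field_simps)
      qed
      show "(\<lambda>m. 1 / real (Suc m)) \<longlonglongrightarrow> 0" by real_asymp
    qed
    then have "(\<lambda>m. S (N m) x / \<mu> (N m)) \<longlonglongrightarrow> 1"
      by (simp add: LIM_zero_iff)
    moreover have "mono (\<lambda>n. S n x)"
      unfolding S_def by (intro monoI sum_mono2) auto
    moreover have "S n x \<ge> 0" for n
      unfolding S_def by (intro sum_nonneg) auto
    ultimately have "(\<lambda>n. S n x / \<mu> n) \<longlonglongrightarrow> 1"
      by (intro tendsto_ratio_of_subseq[of "\<lambda>n. S n x" \<mu> N] mono pos N \<mu>_ratio)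
    then show ?case by (simp add: S_def \<mu>_def)
  qed
qed

end

section \<open>Cantor series with prescribed digits\<close>

definition cantor_partial :: "(nat \<Rightarrow> nat) \<Rightarrow> (nat \<Rightarrow> int) \<Rightarrow> nat \<Rightarrow> real" where
  "cantor_partial q E n = real_of_int (E 0) + (\<Sum>i<n. real_of_int (E (Suc i)) / real (\<Prod>j=1..Suc i. q j))"

text \<open>Only the conditions on digits are kept, with no real number attached, so that the
  results apply both to constructed digits and to any competing expansion in the uniqueness
  proof.\<close>

locale cantor_digit_sequence =
  fixes q :: "nat \<Rightarrow> nat" and E :: "nat \<Rightarrow> int"
  assumes basic: "basic_sequence q"
    and digit: "\<And>n. n \<ge> 1 \<Longrightarrow> E n \<in> {0..int (q n) - 1}"
    and nonmax: "infinite {n. n \<ge> 1 \<and> E n \<noteq> int (q n) - 1}"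
begin

definition P :: "nat \<Rightarrow> real" where "P n = real (\<Prod>j=1..n. q j)"

abbreviation "s \<equiv> cantor_partial q E"

lemma q_pos: "q (Suc n) > 0"
  using basic by (auto simp: basic_sequence_def intro: less_le_trans[of 0 2])

lemma P_0 [simp]: "P 0 = 1"
  by (simp add: P_def)

lemma P_Suc: "P (Suc n) = real (q (Suc n)) * P n"
  by (simp add: P_def)

lemma P_pos [simp]: "P n > 0"
  by (induction n) (simp_all add: P_Suc q_pos)

lemma P_nonneg [simp]: "P n \<ge> 0"
  using P_pos[of n] by linarith

lemma P_neq_0 [simp]: "P n \<noteq> 0"
  using P_pos[of n] by linarith

lemma P_cancel: "P n * (y / P n) = y"
  by simp

lemma partial_0 [simp]: "s 0 = real_of_int (E 0)"
  by (simp add: cantor_partial_def)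

lemma partial_Suc: "s (Suc n) = s n + real_of_int (E (Suc n)) / P (Suc n)"
  by (simp only: cantor_partial_def sum.lessThan_Suc P_def add.assoc)

text \<open>The interval from \<open>s n\<close> to \<open>s n + 1 / P n\<close> splits into
  \<open>q (Suc n)\<close> equal pieces; the digit \<open>E (Suc n)\<close> selects one, and this
  locates its right endpoint. The intervals are therefore nested.\<close>

lemma partial_step:
  "s (Suc n) + 1 / P (Suc n) = s n + (real_of_int (E (Suc n)) + 1) / real (q (Suc n)) / P n"
  unfolding partial_Suc P_Suc by (simp add: add_divide_distrib)

lemma mono_partial: "mono s"
proof (rule incseq_SucI)
  show "s n \<le> s (Suc n)" for n
    unfolding partial_Suc using digit[of "Suc n"] by simp
qed

lemma antimono_upper: "antimono (\<lambda>n. s n + 1 / P n)"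
proof (rule decseq_SucI)
  fix n
  have "(real_of_int (E (Suc n)) + 1) / real (q (Suc n)) \<le> 1"
    using digit[of "Suc n"] q_pos[of n] by (simp add: divide_le_eq)
  then have "(real_of_int (E (Suc n)) + 1) / real (q (Suc n)) / P n \<le> 1 / P n"
    by (intro divide_right_mono) auto
  then show "s (Suc n) + 1 / P (Suc n) \<le> s n + 1 / P n"
    by (simp only: partial_step)
qed

lemma partial_less_upper: "s m < s n + 1 / P n"
proof -
  have "s m \<le> s (max m n)" using mono_partial by (simp add: mono_def)
  also have "\<dots> < s (max m n) + 1 / P (max m n)" by simp
  also have "\<dots> \<le> s n + 1 / P n" using antimono_upper by (simp add: antimono_def)
  finally show ?thesis .
qed

lemma convergent_partial: "\<exists>x. s \<longlonglongrightarrow> x"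
proof -
  have "s m \<le> s 0 + 1" for m using partial_less_upper[of m 0] by simp
  then show ?thesis using mono_partial by (meson incseq_convergent)
qed

lemma limit_le_upper:
  assumes "s \<longlonglongrightarrow> x"
  shows "x \<le> s n + 1 / P n"
  using assms by (rule LIMSEQ_le_const2) (use partial_less_upper less_imp_le in blast)

text \<open>Strictness comes from \<open>nonmax\<close>: at some position \<open>l\<close> beyond
  \<open>n\<close> the digit is not maximal, and there the upper endpoint strictly
  decreases.\<close>

lemma limit_less_upper:
  assumes "s \<longlonglongrightarrow> x"
  shows "x < s n + 1 / P n"
proof -
  obtain l where l: "l > n" "l \<ge> 1" "E l \<noteq> int (q l) - 1"
    using nonmax by (auto simp: infinite_nat_iff_unbounded)
  then obtain m where m: "l = Suc m" "m \<ge> n" by (cases l) auto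
  have "E l + 1 < int (q l)" using digit[of l] l by auto
  then have "real_of_int (E (Suc m)) + 1 < real (q (Suc m))" unfolding m
    by linarith
  then have "(real_of_int (E (Suc m)) + 1) / real (q (Suc m)) < 1"
    using q_pos[of m] by simp
  then have "(real_of_int (E (Suc m)) + 1) / real (q (Suc m)) / P m < 1 / P m"
    by (intro divide_strict_right_mono) simp_all
  then have "s (Suc m) + 1 / P (Suc m) < s m + 1 / P m"
    by (simp only: partial_step)
  moreover have "s m + 1 / P m \<le> s n + 1 / P n"
    using antimono_upper m by (simp add: antimono_def)
  ultimately show ?thesis using limit_le_upper[OF assms, of "Suc m"] by simp
qed

lemma partial_le_limit:
  assumes "s \<longlonglongrightarrow> x"
  shows "s n \<le> x"
  using mono_partial assms by (rule incseq_le)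

text \<open>Horner's scheme for the integer numerator of \<open>s n\<close> over the denominator
  \<open>P n\<close>.\<close>

primrec numer :: "nat \<Rightarrow> int" where
  "numer 0 = E 0"
| "numer (Suc n) = int (q (Suc n)) * numer n + E (Suc n)"

lemma numer: "P n * s n = real_of_int (numer n)"
proof (induction n)
  case 0
  show ?case by (simp add: cantor_partial_def)
next
  case (Suc n)
  have "P (Suc n) * s (Suc n) = P (Suc n) * s n + real_of_int (E (Suc n))"
    unfolding partial_Suc distrib_left by simp
  also have "P (Suc n) * s n = real (q (Suc n)) * (P n * s n)"
    unfolding P_Suc by simp
  finally show ?case by (simp add: Suc)
qed

text \<open>Scaling the half-open interval around \<open>x\<close> by \<open>P n\<close> gives a
  unit interval that starts at the integer \<open>numer n\<close>.\<close>

lemma floor_limit: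
  assumes "s \<longlonglongrightarrow> x"
  shows "\<lfloor>P n * x\<rfloor> = numer n"
proof (rule floor_unique)
  show "real_of_int (numer n) \<le> P n * x"
    unfolding numer[symmetric] by (intro mult_left_mono partial_le_limit assms) simp
  have "P n * x < P n * (s n + 1 / P n)"
    by (intro mult_strict_left_mono limit_less_upper assms) simp
  also have "\<dots> = real_of_int (numer n) + 1"
    by (simp add: distrib_left numer)
  finally show "P n * x < real_of_int (numer n) + 1" .
qed

text \<open>The upper endpoint at level \<open>Suc n\<close>, scaled by \<open>P n\<close>, lets a
  bound on a single digit control the fractional part.\<close>

lemma frac_limit_less:
  assumes "s \<longlonglongrightarrow> x"
  shows "frac (P n * x) < (real_of_int (E (Suc n)) + 1) / real (q (Suc n))"
proof -
  have "P n * x < P n * (s (Suc n) + 1 / P (Suc n))"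
    by (intro mult_strict_left_mono limit_less_upper assms) simp
  also have "\<dots> = real_of_int (numer n) + (real_of_int (E (Suc n)) + 1) / real (q (Suc n))"
    unfolding partial_step by (simp only: distrib_left numer P_cancel)
  finally show ?thesis by (simp add: frac_def floor_limit[OF assms])
qed

text \<open>Solving the recursion of \<open>numer\<close> for the digit expresses it through floors
  that depend on \<open>x\<close> and \<open>q\<close> alone, which yields uniqueness of the
  expansion.\<close>

lemma digits_limit:
  assumes "s \<longlonglongrightarrow> x"
  shows "E 0 = \<lfloor>x\<rfloor>"
    and "E (Suc n) = \<lfloor>P (Suc n) * x\<rfloor> - int (q (Suc n)) * \<lfloor>P n * x\<rfloor>"
  using floor_limit[OF assms, of 0] floor_limit[OF assms, of n] floor_limit[OF assms, of "Suc n"]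
  by simp_all

lemma is_cantor_expansion_limit:
  assumes "s \<longlonglongrightarrow> x"
  shows "is_cantor_expansion q x E"
proof -
  have "(\<lambda>n. s n - real_of_int (E 0)) \<longlonglongrightarrow> x - real_of_int (E 0)"
    by (intro tendsto_intros assms)
  then show ?thesis
    using digit nonmax digits_limit(1)[OF assms]
    by (auto simp: is_cantor_expansion_def sums_def cantor_partial_def)
qed

lemma cantor_digits_limit:
  assumes "s \<longlonglongrightarrow> x"
  shows "cantor_digits q x = E"
  unfolding cantor_digits_def
proof (rule the_equality)
  show "is_cantor_expansion q x E" by (rule is_cantor_expansion_limit[OF assms])
next
  fix F assume F: "is_cantor_expansion q x F"
  then interpret F: cantor_digit_sequence q F
    using basic by unfold_locales (auto simp: is_cantor_expansion_def)
  have "(\<lambda>n. cantor_partial q F n - real_of_int (F 0)) \<longlonglongrightarrow> x - real_of_int (F 0)"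
    using F unfolding is_cantor_expansion_def sums_def cantor_partial_def
    by (elim conjE) simp
  \<comment> \<open>The series in \<open>is_cantor_expansion\<close> omits the integer part; adding
    it back shows that both digit sequences have the limit \<open>x\<close>.\<close>
  then have lim: "cantor_partial q F \<longlonglongrightarrow> x"
    using tendsto_add[OF _ tendsto_const[of "real_of_int (F 0)"]] by fastforce
  show "F = E"
  proof
    show "F n = E n" for n
      by (cases n) (simp_all only: digits_limit[OF assms] F.digits_limit[OF lim])
  qed
qed

end

section \<open>Independent uniform digits and block events\<close>

text \<open>Coordinate \<open>0\<close> has an unspecified distribution when \<open>q 0 = 0\<close>, but no block event involves it.\<close>

definition uniform_digits :: "(nat \<Rightarrow> nat) \<Rightarrow> (nat \<Rightarrow> nat) measure" where
  "uniform_digits q = (\<Pi>\<^sub>M i\<in>UNIV. measure_pmf (pmf_of_set {..<q i}))"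

lemma space_uniform_digits [simp]: "space (uniform_digits q) = UNIV"
  by (simp add: uniform_digits_def space_PiM PiE_UNIV_domain)

lemma prob_space_uniform_digits: "prob_space (uniform_digits q)"
  unfolding uniform_digits_def by (intro prob_space_PiM measure_pmf.prob_space_axioms)

lemma measurable_uniform_digits:
  assumes "finite J"
  shows "{w. \<forall>i\<in>J. w i = f i} \<in> sets (uniform_digits q)"
proof -
  have "{w \<in> space (uniform_digits q). \<forall>i\<in>J. w i \<in> {f i}} \<in> sets (uniform_digits q)"
    unfolding uniform_digits_def using assms
    by (intro sets.sets_Collect_finite_All sets_Collect_single) auto
  then show ?thesis by simp
qed

text \<open>The set is a finite-dimensional cylinder, so the product measure factors;
  \<open>f i < q i\<close> puts each prescribed value in the support of its coordinate.\<close>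

lemma measure_uniform_digits:
  assumes "finite J" and f: "\<And>i. i \<in> J \<Longrightarrow> f i < q i"
  shows "measure (uniform_digits q) {w. \<forall>i\<in>J. w i = f i} = (\<Prod>i\<in>J. 1 / real (q i))"
proof -
  interpret product_prob_space "\<lambda>i. measure_pmf (pmf_of_set {..<q i})" UNIV
    by (intro product_prob_spaceI measure_pmf.prob_space_axioms)
  have "{w. \<forall>i\<in>J. w i = f i} = emb UNIV J (\<Pi>\<^sub>E i\<in>J. {f i})"
    by (auto simp: prod_emb_def PiE_UNIV_domain restrict_PiE_iff)
  moreover have "measure (measure_pmf (pmf_of_set {..<q i})) {f i} = 1 / real (q i)" if "i \<in> J" for i
    using f[OF that] by (subst measure_pmf_single, subst pmf_of_set) auto
  ultimately show ?thesis
    unfolding uniform_digits_def using measure_PiM_emb[of J "\<lambda>i. {f i}"] assms(1)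
    by simp
qed

text \<open>
  Reducing the entries of \<open>B\<close> modulo the bases changes only finitely many of these events
  and makes their probabilities equal to the summands of \<open>block_sum\<close> without exception.
\<close>

definition block_event :: "(nat \<Rightarrow> nat) \<Rightarrow> nat list \<Rightarrow> nat \<Rightarrow> (nat \<Rightarrow> nat) set" where
  "block_event q B i = {w. \<forall>j<length B. w (i + j) = B ! j mod q (i + j)}"

lemma block_event_conv:
  "block_event q B i = {w. \<forall>n\<in>{i..<i + length B}. w n = B ! (n - i) mod q n}"
proof -
  have "{i..<i + length B} = (+) i ` {..<length B}"
    by (simp add: lessThan_atLeast0 add.commute)
  then show ?thesis by (auto simp: block_event_def)
qed

lemma sets_block_event [measurable]: "block_event q B i \<in> sets (uniform_digits q)"
  unfolding block_event_conv by (rule measurable_uniform_digits) simp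

lemma measure_block_event:
  assumes "basic_sequence q" "i \<ge> 1"
  shows "measure (uniform_digits q) (block_event q B i) = (\<Prod>n\<in>{i..<i + length B}. 1 / real (q n))"
  unfolding block_event_conv
proof (rule measure_uniform_digits)
  fix n assume "n \<in> {i..<i + length B}"
  then have "q n \<ge> 2" using assms by (auto simp: basic_sequence_def)
  then show "B ! (n - i) mod q n < q n" by simp
qed simp

text \<open>The two windows of coordinates are disjoint, so the intersection is again a cylinder,
  with the glued values \<open>f\<close>, and its product of reciprocals splits.\<close>

lemma measure_block_event_Int:
  assumes "basic_sequence q" "i \<ge> 1" and le: "i + length B \<le> i'"
  shows "measure (uniform_digits q) (block_event q B i \<inter> block_event q B i') =
    measure (uniform_digits q) (block_event q B i) * measure (uniform_digits q) (block_event q B i')"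
proof -
  define I where "I = {i..<i + length B}"
  define I' where "I' = {i'..<i' + length B}"
  define f where "f n = (if n \<in> I then B ! (n - i) mod q n else B ! (n - i') mod q n)" for n
  have disj: "I \<inter> I' = {}" using le by (auto simp: I_def I'_def)
  have "block_event q B i \<inter> block_event q B i' = {w. \<forall>n\<in>I \<union> I'. w n = f n}"
    unfolding block_event_conv I_def[symmetric] I'_def[symmetric] f_def using disj by auto
  moreover have "f n < q n" if "n \<in> I \<union> I'" for n
  proof -
    have "n \<ge> 1" using that assms by (auto simp: I_def I'_def)
    then have "q n \<ge> 2" using assms by (auto simp: basic_sequence_def)
    then show ?thesis by (simp add: f_def)
  qed
  ultimately have "measure (uniform_digits q) (block_event q B i \<inter> block_event q B i')
      = (\<Prod>n\<in>I \<union> I'. 1 / real (q n))"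
    by (simp only:, intro measure_uniform_digits) (simp_all add: I_def I'_def)
  also have "\<dots> = (\<Prod>n\<in>I. 1 / real (q n)) * (\<Prod>n\<in>I'. 1 / real (q n))"
    by (intro prod.union_disjoint disj) (simp_all add: I_def I'_def)
  finally show ?thesis
    using assms by (simp add: measure_block_event I_def I'_def)
qed

lemma block_sum_conv:
  "block_sum q k n = (\<Sum>i<n. \<Prod>m\<in>{Suc i..<Suc i + k}. 1 / real (q m))"
proof -
  have "1 / real (\<Prod>j<k. q (i + j)) = (\<Prod>m\<in>{i..<i + k}. 1 / real (q m))" for i
    using prod.shift_bounds_nat_ivl[of "\<lambda>m. 1 / real (q m)" 0 i k]
    by (simp add: prod_dividef lessThan_atLeast0 add.commute)
  then show ?thesis
    by (simp add: block_sum_def sum.atLeast1_atMost_eq)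
qed

lemma exists_normal_digits:
  assumes q: "basic_sequence q" "fully_divergent q"
  shows "\<exists>w. \<forall>B. B \<noteq> [] \<longrightarrow>
    (\<lambda>n. (\<Sum>i<n. indicator (block_event q B (Suc i)) w) / block_sum q (length B) n) \<longlonglongrightarrow> 1"
proof -
  interpret prob_space "uniform_digits q" by (rule prob_space_uniform_digits)
  have "AE w in uniform_digits q. B \<noteq> [] \<longrightarrow>
    (\<lambda>n. (\<Sum>i<n. indicator (block_event q B (Suc i)) w) / block_sum q (length B) n) \<longlonglongrightarrow> 1" for B
  proof (cases "B = []")
    case False
    have bs: "block_sum q (length B) n = (\<Sum>i<n. prob (block_event q B (Suc i)))" for n
      using q by (simp add: measure_block_event block_sum_conv)
    have "length B \<ge> 1" using False by (cases B) auto
    then have "filterlim (block_sum q (length B)) at_top sequentially"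
      using q by (simp add: fully_divergent_def)
    then have "AE w in uniform_digits q.
      (\<lambda>n. (\<Sum>i<n. indicator (block_event q B (Suc i)) w) / block_sum q (length B) n) \<longlonglongrightarrow> 1"
      unfolding bs using q
      by (intro AE_count_ratio_tendsto_1[where k = "length B"] measure_block_event_Int) auto
    then show ?thesis by auto
  qed simp
  \<comment> \<open>There are only countably many blocks, so one null set serves them all; its
    complement is nonempty because the total mass is 1.\<close>
  then have "AE w in uniform_digits q. \<forall>B. B \<noteq> [] \<longrightarrow>
    (\<lambda>n. (\<Sum>i<n. indicator (block_event q B (Suc i)) w) / block_sum q (length B) n) \<longlonglongrightarrow> 1"
    by (simp add: AE_all_countable)
  then have "\<exists>w. \<forall>B. B \<noteq> [] \<longrightarrow>
    (\<lambda>n. (\<Sum>i<n. indicator (block_event q B (Suc i)) w) / block_sum q (length B) n) \<longlonglongrightarrow> 1"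
    using eventually_happens'[OF ae_filter_bot] by blast
  then show ?thesis .
qed

section \<open>Capped digits: normality kept, distribution normality lost\<close>

text \<open>The two partial sums eventually differ by a constant \<open>d\<close>, which is
  negligible against \<open>\<mu>\<close>.\<close>

lemma ratio_tendsto_cong_eventually:
  fixes a b :: "nat \<Rightarrow> real"
  assumes "(\<lambda>n. (\<Sum>i<n. a i) / \<mu> n) \<longlonglongrightarrow> c"
    and eq: "eventually (\<lambda>i. a i = b i) sequentially"
    and \<mu>: "filterlim \<mu> at_top sequentially"
  shows "(\<lambda>n. (\<Sum>i<n. b i) / \<mu> n) \<longlonglongrightarrow> c"
proof -
  obtain N where N: "\<And>i. i \<ge> N \<Longrightarrow> a i = b i"
    using eq by (auto simp: eventually_sequentially)
  define d where "d = (\<Sum>i<N. b i - a i)"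
  have "(\<Sum>i<n. b i - a i) = d" if "n \<ge> N" for n
    unfolding d_def using that N by (intro sum.mono_neutral_right) auto
  then have "(\<Sum>i<n. b i) = (\<Sum>i<n. a i) + d" if "n \<ge> N" for n
    using that by (simp add: sum_subtractf algebra_simps)
  then have ev: "eventually (\<lambda>n. (\<Sum>i<n. a i) / \<mu> n + d / \<mu> n = (\<Sum>i<n. b i) / \<mu> n) sequentially"
    by (intro eventually_sequentiallyI[of N]) (simp add: add_divide_distrib)
  have "(\<lambda>n. d / \<mu> n) \<longlonglongrightarrow> 0"
    by (rule tendsto_divide_0[OF tendsto_const filterlim_at_top_imp_at_infinity[OF \<mu>]])
  from tendsto_add[OF assms(1) this] show ?thesis
    by (simp add: tendsto_cong[OF ev])
qed

theorem theorem3p12: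
  fixes q :: "nat \<Rightarrow> nat"
  assumes "basic_sequence q"
    and "infinite_in_limit q"
    and "fully_divergent q"
  shows "normal_numbers q - distribution_normal_numbers q \<noteq> {}"
proof -
  obtain w where w: "\<And>B. B \<noteq> [] \<Longrightarrow>
    (\<lambda>n. (\<Sum>i<n. indicator (block_event q B (Suc i)) w) / block_sum q (length B) n) \<longlonglongrightarrow> 1"
    using exists_normal_digits[OF assms(1,3)] by blast
  \<comment> \<open>The cap keeps every digit in the lower half of its range. It also handles values
    of \<open>w\<close> outside the range, since \<open>w\<close> is just some point of the full
    product space.\<close>
  define E where "E n = (if n = 0 then 0 else int (min (w n) (q n div 2 - 1)))" for n
  have q2: "q n \<ge> 2" if "n \<ge> 1" for n
    using assms(1) that by (simp add: basic_sequence_def)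
  \<comment> \<open>This one inequality gives the digit range, excludes maximal digits and later
    bounds the fractional parts by 1/2.\<close>
  have half: "2 * (E n + 1) \<le> int (q n)" if "n \<ge> 1" for n
    using q2[OF that] that by (auto simp: E_def)
  have nonneg: "E n \<ge> 0" for n
    by (simp add: E_def)
  interpret cantor_digit_sequence q E
  proof
    have "E n \<noteq> int (q n) - 1" if "n \<ge> 1" for n
      using half[OF that] nonneg[of n] by auto
    then have "{n. n \<ge> 1 \<and> E n \<noteq> int (q n) - 1} = {1..}" by auto
    then show "infinite {n. n \<ge> 1 \<and> E n \<noteq> int (q n) - 1}"
      by (simp add: infinite_Ici)
    show "E n \<in> {0..int (q n) - 1}" if "n \<ge> 1" for n
      using half[OF that] nonneg[of n] by auto
  qed (rule assms)
  obtain x where x: "s \<longlonglongrightarrow> x" using convergent_partial by blast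
  have "x \<in> normal_numbers q"
    unfolding normal_numbers_def mem_Collect_eq
  proof (intro allI impI)
    fix k :: nat and B :: "nat list" assume k: "k \<ge> 1" "length B = k"
    let ?occ = "\<lambda>i. \<forall>j<length B. E (i + j) = int (B ! j)"
    \<comment> \<open>The sum of the entries is a convenient upper bound for each of them.\<close>
    define m where "m = (\<Sum>b\<leftarrow>B. b)"
    have le_m: "B ! j \<le> m" if "j < length B" for j
      using that unfolding m_def by (simp add: member_le_sum_list)
    have "eventually (\<lambda>i. 2 * m + 4 \<le> q i) sequentially"
      using assms(2) by (simp add: infinite_in_limit_def filterlim_at_top)
    then obtain i0 where i0: "\<And>i. i \<ge> i0 \<Longrightarrow> 2 * m + 4 \<le> q i"
      by (auto simp: eventually_sequentially)
    \<comment> \<open>From \<open>2 * m + 4 \<le> q n\<close> each entry of \<open>B\<close> lies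
      strictly below the cap \<open>q n div 2 - 1\<close>. Capping thus neither creates nor destroys
      the entry, and the reduction modulo \<open>q n\<close> is the identity on it.\<close>
    have "w \<in> block_event q B (Suc i) \<longleftrightarrow> ?occ (Suc i)" if "i \<ge> i0" for i
    proof -
      have "w (Suc i + j) = B ! j mod q (Suc i + j) \<longleftrightarrow> E (Suc i + j) = int (B ! j)"
        if "j < length B" for j
      proof -
        have *: "2 * m + 4 \<le> q (Suc i + j)" using i0 \<open>i \<ge> i0\<close> by simp
        then have "B ! j < q (Suc i + j) div 2 - 1" "B ! j < q (Suc i + j)"
          using le_m[OF that] by linarith+
        then show ?thesis by (auto simp: E_def min_def)
      qed
      then show ?thesis by (auto simp: block_event_def)
    qed
    then have occ: "eventually
        (\<lambda>i. indicator (block_event q B (Suc i)) w = (of_bool (?occ (Suc i)) :: real)) sequentially"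
      by (intro eventually_sequentiallyI[of i0]) (simp add: indicator_def)
    have div: "filterlim (block_sum q (length B)) at_top sequentially"
      using assms(3) k by (simp add: fully_divergent_def)
    have "B \<noteq> []" using k by auto
    from ratio_tendsto_cong_eventually[OF w[OF this] occ div]
    have "(\<lambda>n. (\<Sum>i<n. of_bool (?occ (Suc i))) / block_sum q k n) \<longlonglongrightarrow> 1"
      by (simp only: k)
    moreover have "real (block_count q B x n) = (\<Sum>i<n. of_bool (?occ (Suc i)))" for n
    proof -
      have "real (block_count q B x n) = (\<Sum>i\<in>{1..n}. of_bool (?occ i))"
        by (simp add: block_count_def cantor_digits_limit[OF x] Int_def)
      then show ?thesis by (simp only: One_nat_def sum.atLeast1_atMost_eq)
    qed
    ultimately show "(\<lambda>n. real (block_count q B x n) / block_sum q k n) \<longlonglongrightarrow> 1" by simp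
  qed
  moreover have "x \<notin> distribution_normal_numbers q"
  proof
    assume "x \<in> distribution_normal_numbers q"
    \<comment> \<open>The upper half of the unit interval is the test set: uniform distribution
      demands frequency 1/2, while no fractional part falls there.\<close>
    then have "(\<lambda>N. real (card {n. n < N \<and> frac (P n * x) \<in> {1/2..<1}}) / real N) \<longlonglongrightarrow> 1 - 1/2"
      unfolding distribution_normal_numbers_def uniformly_distributed_mod1_def P_def
      by (elim CollectE allE[of _ "1/2"] allE[of _ 1]) auto
    moreover have "frac (P n * x) < 1/2" for n
    proof -
      have "2 * (real_of_int (E (Suc n)) + 1) \<le> real (q (Suc n))"
        using half[of "Suc n"] of_int_le_iff[of "2 * (E (Suc n) + 1)" "int (q (Suc n))", where 'a = real]
        by simp
      then have "(real_of_int (E (Suc n)) + 1) / real (q (Suc n)) \<le> 1/2"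
        using q_pos[of n] by (simp add: field_simps)
      then show ?thesis using frac_limit_less[OF x, of n] by linarith
    qed
    then have "{n. n < N \<and> frac (P n * x) \<in> {1/2..<1}} = {}" for N
      by (force simp: not_le)
    ultimately have "(\<lambda>N. real (card ({} :: nat set)) / real N) \<longlonglongrightarrow> 1 - 1/2" by (simp only:)
    then have "(\<lambda>N. 0 :: real) \<longlonglongrightarrow> 1/2" by simp
    then show False by (simp add: LIMSEQ_const_iff)
  qed
  ultimately show ?thesis by blast
qed

end
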